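(* Let $1\le r<n$ and let $A\in\mathbb{R}^{n\times n}$ be symmetric with eigenvalues $\lambda_1\ge\dots\ge\lambda_n$ satisfying $\lambda_r>\lambda_{r+1}$, and eigen-decomposition $A=V_1\Lambda_1V_1^T+V_2\Lambda_2V_2^T$, where $\Lambda_1=\mathrm{diag}(\lambda_1,\dots,\lambda_r)$, $\Lambda_2=\mathrm{diag}(\lambda_{r+1},\dots,\lambda_n)$, and $V_1\in\mathbb{R}^{n\times r}$, $V_2\in\mathbb{R}^{n\times(n-r)}$ have orthonormal columns that are the associated eigenvectors. Let $E\in\mathbb{R}^{n\times n}$ be symmetric, $\widehat A=A+E$, and $$\mathsf{gap}=\min\{\mathsf{sep}_2(\Lambda_1,\Lambda_2),\ \mathsf{sep}_{(2,\infty),V_2}(\Lambda_1,V_2\Lambda_2V_2^T)\}.$$ If $\|E\|_2\le \frac{\mathsf{gap}}{5}$, then $$\|\widehat V_1\widetilde U-V_1\|_{2,\infty}\le 8\|V_1\|_{2,\infty}\left(\frac{\|E_{2,1}\|_2}{\mathsf{sep}_2(\Lambda_1,\Lambda_2)}\right)^2+2\,\frac{\|V_2E_{2,1}\|_{2,\infty}}{\mathsf{gap}}+4\,\frac{\|V_2E_{2,2}V_2^T\|_{2,\infty}\,\|E_{2,1}\|_2}{\mathsf{gap}\cdot\mathsf{sep}_2(\Lambda_1,\Lambda_2)},$$ where $\widehat V_1\in\mathbb{R}^{n\times r}$ is any matrix with orthonormal columns whose range is the dominant $r$-dimensional invariant subspace of $\widehat A$, and $\widetilde U$ solves the orthogonal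 Procrustes problem $\min\{\|\widehat V_1U-V_1\|_F: U\in\mathbf{O}^r\}$.
   Context: $\mathbf{O}^r$ is the set of $r\times r$ orthogonal matrices. The dominant $r$-dimensional invariant subspace of a symmetric matrix is the one associated with its $r$ algebraically largest eigenvalues. $\|\cdot\|_2$ is the spectral norm, $\|\cdot\|_F$ the Frobenius norm, and $\|B\|_{2,\infty}=\max_i\|B_{i,:}\|_2$ is the maximum Euclidean norm of the rows of $B$. For $B\in\mathbb{R}^{n\times n}$ and $i,j\in\{1,2\}$, $B_{i,j}:=V_i^TBV_j$. For $B\in\mathbb{R}^{\ell\times\ell}$, $C\in\mathbb{R}^{m\times m}$ and a norm $\|\cdot\|_*$ on $\mathbb{R}^{m\times\ell}$, $\mathsf{sep}_*(B,C)=\inf\{\|ZB-CZ\|_*: Z\in\mathbb{R}^{m\times\ell},\ \|Z\|_*=1\}$. For a matrix $W$ with $m$ rows and orthonormal columns, $\mathsf{sep}_{*,W}(B,C)=\inf\{\|ZB-CZ\|_*: Z\in\mathbb{R}^{m\times\ell},\ \text{every column of } Z \text{ lies in } \mathrm{ran}\,W,\ \|Z\|_*=1\}$. The subscripts $2$ and $(2,\infty)$ refer to the norms $\|\cdot\|_2$ and $\|\cdot\|_{2,\infty}$. *)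

theory Defs
  imports "HOL-Analysis.Analysis"
begin

abbreviation spectral_norm :: "real^'l^'m \<Rightarrow> real" where
  "spectral_norm B \<equiv> onorm ((*v) B)"

definition frobenius_norm :: "real^'l^'m \<Rightarrow> real" where
  "frobenius_norm B = sqrt (\<Sum>i\<in>UNIV. \<Sum>j\<in>UNIV. (B $ i $ j)\<^sup>2)"

definition two_inf_norm :: "real^'l^'m \<Rightarrow> real" where
  "two_inf_norm B = (MAX i. norm (row i B))"

definition diag_mat :: "('m \<Rightarrow> real) \<Rightarrow> real^'m^'m" where
  "diag_mat d = (\<chi> i j. if i = j then d i else 0)"

definition orthonormal_columns :: "real^'l^'m \<Rightarrow> bool" where
  "orthonormal_columns W \<longleftrightarrow> transpose W ** W = mat 1"

text \<open>
  The separation of \<open>B\<close> and \<open>C\<close> in the norm \<open>N\<close>. The infimum is that of a set of reals, which is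
  nonempty and bounded below whenever \<open>N\<close> is a norm (and, for \<open>sep_in\<close>, \<open>W\<close> is nonzero).
\<close>

definition sep :: "(real^'l^'m \<Rightarrow> real) \<Rightarrow> real^'l^'l \<Rightarrow> real^'m^'m \<Rightarrow> real" where
  "sep N B C = Inf {N (Z ** B - C ** Z) | Z. N Z = 1}"

definition sep_in ::
    "(real^'l^'m \<Rightarrow> real) \<Rightarrow> real^'k^'m \<Rightarrow> real^'l^'l \<Rightarrow> real^'m^'m \<Rightarrow> real" where
  "sep_in N W B C =
     Inf {N (Z ** B - C ** Z) | Z. (\<forall>j. column j Z \<in> range ((*v) W)) \<and> N Z = 1}"

text \<open>
  \<open>S\<close> is spanned by the first \<open>k\<close> vectors of an orthonormal eigenbasis of the (symmetric) matrix \<open>M\<close>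
  ordered by nonincreasing eigenvalue. If the \<open>k\<close>-th and \<open>(k+1)\<close>-st eigenvalues of \<open>M\<close> coincide,
  then several subspaces qualify.
\<close>

definition dominant_invariant_subspace :: "nat \<Rightarrow> real^'n^'n \<Rightarrow> (real^'n) set \<Rightarrow> bool" where
  "dominant_invariant_subspace k M S \<longleftrightarrow>
     k \<le> CARD('n) \<and>
     (\<exists>(\<mu> :: nat \<Rightarrow> real) (v :: nat \<Rightarrow> real^'n).
        (\<forall>i\<in>{1..CARD('n)}. \<forall>j\<in>{1..CARD('n)}. v i \<bullet> v j = (if i = j then 1 else 0)) \<and>
        (\<forall>i\<in>{1..CARD('n)}. M *v v i = \<mu> i *\<^sub>R v i) \<and>
        (\<forall>i\<in>{1..CARD('n)}. \<forall>j\<in>{1..CARD('n)}. i \<le> j \<longrightarrow> \<mu> j \<le> \<mu> i) \<and>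
        S = span (v ` {1..k}))"

text \<open>
  Matrix columns are indexed by finite types, eigenvalues by the numbers \<open>1, \<dots>, n\<close>. In the theorem
  the bijections \<open>p1\<close> and \<open>p2\<close> number the columns of \<open>V1\<close> by \<open>1, \<dots>, r\<close> and those of \<open>V2\<close> by
  \<open>r+1, \<dots>, n\<close>; thus \<open>diag_mat (\<lambda>i. lam (p1 i))\<close> is \<open>diag(\<lambda>\<^sub>1, \<dots>, \<lambda>\<^sub>r)\<close>.
\<close>

end

theory Submission
  imports Defs
begin

text \<open>
  Let \<open>W\<close> be the aligned basis \<open>Vhat1 ** Ut\<close>, with coordinates \<open>C = V1\<^sup>T W\<close> and \<open>S = V2\<^sup>T W\<close>.
  Optimality of \<open>Ut\<close> makes \<open>C\<close> symmetric positive semidefinite, so that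
  \<open>(I + C)(I - C) = S\<^sup>T S\<close> yields \<open>\<parallel>I - C\<parallel> \<le> \<parallel>S\<parallel>\<^sup>2\<close>. As the spectra are ordered, a
  sine-theta argument gives \<open>\<parallel>S\<parallel> \<le> (5/3) \<parallel>E21\<parallel> / sep\<close>. Finally \<open>W - V1 = V1 (C - I) + V2 X C\<close>
  with \<open>X = S C\<^sup>-\<^sup>1\<close>, and \<open>X\<close> solves a Riccati equation; applying \<open>sep_in\<close> to \<open>V2 X\<close> bounds the
  rows of \<open>V2 X\<close>.
\<close>

section \<open>Matrix algebra, the spectral norm and the maximum row norm\<close>

declare transpose_matrix_vector [simp del]


lemma inner_matrix_vector: "x \<bullet> ((B::real^'l^'m) *v y) = (transpose B *v x) \<bullet> y"
  by (simp add: dot_lmul_matrix transpose_matrix_vector)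

lemma matrix_diff_ldistrib: "(A::real^'l^'m) ** (B - C) = A ** B - A ** C"
  by (simp add: matrix_eq algebra_simps flip: matrix_vector_mul_assoc)

lemma matrix_diff_rdistrib: "((B::real^'l^'m) - C) ** A = B ** A - C ** A"
  by (simp add: matrix_eq algebra_simps flip: matrix_vector_mul_assoc)

lemma matrix_add_rdistrib: "((B::real^'l^'m) + C) ** A = B ** A + C ** A"
  by (simp add: matrix_eq algebra_simps flip: matrix_vector_mul_assoc)

lemma matrix_mult_0_left [simp]: "0 ** (A::real^'l^'m) = 0"
  by (simp add: matrix_eq flip: matrix_vector_mul_assoc)

lemma matrix_mult_0_right [simp]: "(A::real^'l^'m) ** 0 = 0"
  by (simp add: matrix_eq flip: matrix_vector_mul_assoc)

lemma transpose_0 [simp]: "transpose (0::real^'l^'m) = 0"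
  by (simp add: transpose_def vec_eq_iff)

lemma transpose_diff: "transpose ((A::real^'l^'m) - B) = transpose A - transpose B"
  by (simp add: transpose_def vec_eq_iff)

lemma transpose_add: "transpose ((A::real^'l^'m) + B) = transpose A + transpose B"
  by (simp add: transpose_def vec_eq_iff)

lemma diag_mat_mult_vec: "diag_mat d *v x = (\<chi> i. d i * x $ i)"
  by (simp add: diag_mat_def matrix_vector_mult_def vec_eq_iff if_distrib if_distribR sum.delta cong: if_cong)

lemma norm_matrix_vector_le: "norm ((B::real^'l^'m) *v x) \<le> spectral_norm B * norm x"
  by (rule onorm) simp

lemma spectral_norm_nonneg [simp]: "0 \<le> spectral_norm (B::real^'l^'m)"
  by (rule onorm_pos_le) simp

lemma abs_inner_matrix_le: "\<bar>x \<bullet> ((B::real^'m^'m) *v x)\<bar> \<le> spectral_norm B * (x \<bullet> x)"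
proof -
  have "\<bar>x \<bullet> (B *v x)\<bar> \<le> norm x * (spectral_norm B * norm x)"
    by (meson Cauchy_Schwarz_ineq2 mult_left_mono norm_ge_zero norm_matrix_vector_le order_trans)
  then show ?thesis
    by (simp add: dot_square_norm power2_eq_square algebra_simps)
qed

text \<open>With \<open>y = B\<^sup>T x\<close> one has
  \<open>norm y * norm y = x \<bullet> (B y)\<close>; Cauchy-Schwarz and cancellation of one factor
  \<open>norm y\<close> give the bound. The same bound for the transpose then yields
  equality.\<close>

lemma spectral_norm_transpose_le: "spectral_norm (transpose (B::real^'l^'m)) \<le> spectral_norm B"
proof (rule onorm_bound)
  fix x
  let ?y = "transpose B *v x"
  have "norm ?y * norm ?y = x \<bullet> (B *v ?y)"
    by (simp add: inner_matrix_vector power2_norm_eq_inner flip: power2_eq_square)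
  also have "\<dots> \<le> norm x * (spectral_norm B * norm ?y)"
    by (meson mult_left_mono norm_cauchy_schwarz norm_ge_zero norm_matrix_vector_le order_trans)
  finally show "norm ?y \<le> spectral_norm B * norm x"
    by (cases "norm ?y = 0") (auto simp: mult.commute mult.left_commute)
qed simp

lemma spectral_norm_transpose [simp]: "spectral_norm (transpose (B::real^'l^'m)) = spectral_norm B"
  using spectral_norm_transpose_le[of B] spectral_norm_transpose_le[of "transpose B"] by simp

lemma spectral_norm_mult_le:
  "spectral_norm ((A::real^'l^'m) ** (B::real^'k^'l)) \<le> spectral_norm A * spectral_norm B"
  using onorm_compose[of "(*v) A" "(*v) B"]
  by (simp add: o_def matrix_vector_mul_assoc)

lemma two_inf_norm_row_le: "norm (row i (B::real^'l^'m)) \<le> two_inf_norm B"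
  unfolding two_inf_norm_def by (rule Max_ge) auto

lemma two_inf_norm_leI: "(\<And>i. norm (row i (B::real^'l^'m)) \<le> c) \<Longrightarrow> two_inf_norm B \<le> c"
  unfolding two_inf_norm_def by (subst Max_le_iff) auto

lemma two_inf_norm_nonneg [simp]: "0 \<le> two_inf_norm (B::real^'l^'m)"
  using two_inf_norm_row_le norm_ge_zero order_trans by blast

lemma two_inf_norm_add_le: "two_inf_norm ((A::real^'l^'m) + B) \<le> two_inf_norm A + two_inf_norm B"
proof (rule two_inf_norm_leI)
  fix i
  have "row i (A + B) = row i A + row i B"
    by (simp add: row_def vec_eq_iff)
  then show "norm (row i (A + B)) \<le> two_inf_norm A + two_inf_norm B"
    by (metis add_mono norm_triangle_le two_inf_norm_row_le)
qed

text \<open>For nonzero \<open>c\<close> the reverse inequality is the upper bound applied to the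
  factor \<open>inverse c\<close> and the matrix \<open>c B\<close>.\<close>

lemma two_inf_norm_scaleR: "two_inf_norm (c *\<^sub>R (B::real^'l^'m)) = \<bar>c\<bar> * two_inf_norm B"
proof -
  have r: "row i (c *\<^sub>R B) = c *\<^sub>R row i B" for c i and B :: "real^'l^'m"
    by (simp add: row_def vec_eq_iff)
  have le: "two_inf_norm (c *\<^sub>R B) \<le> \<bar>c\<bar> * two_inf_norm B" for c and B :: "real^'l^'m"
    by (rule two_inf_norm_leI) (simp add: r mult_left_mono two_inf_norm_row_le)
  show ?thesis
  proof (cases "c = 0")
    case True
    then show ?thesis using le[of 0 B] by (simp add: order_antisym)
  next
    case False
    then have "\<bar>c\<bar> * two_inf_norm B \<le> two_inf_norm (c *\<^sub>R B)"
      using le[of "inverse c" "c *\<^sub>R B"] by (simp add: abs_inverse field_simps)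
    then show ?thesis using le[of c B] by simp
  qed
qed

lemma two_inf_norm_diff_le: "two_inf_norm ((A::real^'l^'m) - B) \<le> two_inf_norm A + two_inf_norm B"
  using two_inf_norm_add_le[of A "(-1) *\<^sub>R B"] two_inf_norm_scaleR[of "-1" B] by simp

lemma two_inf_norm_eq_0: "two_inf_norm (B::real^'l^'m) = 0 \<Longrightarrow> B = 0"
  using two_inf_norm_row_le[of _ B] by (simp add: vec_eq_iff row_def)

text \<open>Row \<open>i\<close> of the product is \<open>transpose B\<close> applied to row
  \<open>i\<close> of \<open>A\<close>, so a right factor costs only its spectral norm.\<close>

lemma two_inf_norm_mult_le:
  "two_inf_norm ((A::real^'l^'m) ** (B::real^'k^'l)) \<le> two_inf_norm A * spectral_norm B"
proof (rule two_inf_norm_leI)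
  fix i
  have "row i (A ** B) = transpose B *v row i A"
    by (simp add: row_def vec_eq_iff matrix_matrix_mult_def matrix_vector_mult_def transpose_def mult.commute)
  then have "norm (row i (A ** B)) \<le> spectral_norm B * norm (row i A)"
    using norm_matrix_vector_le[of "transpose B" "row i A"] by simp
  also have "\<dots> \<le> spectral_norm B * two_inf_norm A"
    by (simp add: mult_left_mono two_inf_norm_row_le)
  finally show "norm (row i (A ** B)) \<le> two_inf_norm A * spectral_norm B"
    by (simp add: mult.commute)
qed

lemma two_inf_norm_mult_le_unit:
  "spectral_norm B \<le> c \<Longrightarrow> two_inf_norm ((A::real^'l^'m) ** (B::real^'k^'l)) \<le> two_inf_norm A * c"
  using two_inf_norm_mult_le[of A B] mult_left_mono[of "spectral_norm B" c "two_inf_norm A"] by simp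

lemma norm_orthonormal_columns:
  assumes "orthonormal_columns (W::real^'l^'m)" shows "norm (W *v x) = norm x"
proof -
  have "(W *v x) \<bullet> (W *v x) = x \<bullet> x"
    using assms by (simp add: inner_matrix_vector matrix_vector_mul_assoc orthonormal_columns_def)
  then show ?thesis by (simp add: norm_eq_sqrt_inner)
qed

lemma spectral_norm_orthonormal_columns_le:
  assumes "orthonormal_columns (W::real^'l^'m)" shows "spectral_norm W \<le> 1"
  by (rule onorm_bound) (simp_all add: norm_orthonormal_columns assms)

text \<open>Both outer factors are contractions; hence the blocks of \<open>E\<close> in the
  eigenbasis of \<open>A\<close> are no larger than \<open>E\<close>.\<close>

lemma spectral_norm_compression_le:
  assumes V: "orthonormal_columns (V::real^'l^'m)" and W: "orthonormal_columns (W::real^'k^'m)"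
  shows "spectral_norm (transpose V ** E ** W) \<le> spectral_norm (E::real^'m^'m)"
proof -
  have "spectral_norm (transpose V ** E ** W) \<le> spectral_norm (transpose V ** E) * spectral_norm W"
    by (rule spectral_norm_mult_le)
  also have "\<dots> \<le> spectral_norm (transpose V ** E) * 1"
    using spectral_norm_orthonormal_columns_le[OF W] by (intro mult_left_mono) simp_all
  also have "\<dots> \<le> spectral_norm V * spectral_norm E"
    using spectral_norm_mult_le[of "transpose V" E] by simp
  also have "\<dots> \<le> 1 * spectral_norm E"
    using spectral_norm_orthonormal_columns_le[OF V] by (intro mult_right_mono) simp_all
  finally show ?thesis by simp
qed

text \<open>The Sylvester operator is tested against a pair of leading singular vectors of \<open>S\<close>.\<close>

lemma spectral_norm_sylvester_ge:
  fixes S :: "real^'l^'m" and B :: "real^'l^'l" and C :: "real^'m^'m"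
  assumes B: "\<And>x. b * (x \<bullet> x) \<le> x \<bullet> (B *v x)" and C: "\<And>y. y \<bullet> (C *v y) \<le> c * (y \<bullet> y)"
  shows "(b - c) * spectral_norm S \<le> spectral_norm (S ** B - C ** S)"
proof -
  let ?R = "S ** B - C ** S"
  define \<sigma> where "\<sigma> = spectral_norm S"
  \<comment> \<open>Compactness of the unit sphere supplies a maximiser \<open>u\<close>, a leading
    right singular vector of \<open>S\<close>.\<close>
  have "\<exists>u\<in>sphere 0 1. \<forall>y\<in>sphere 0 1. norm (S *v y) \<le> norm (S *v u)"
    proof (rule continuous_attains_sup)
    show "sphere (0::real^'l) 1 \<noteq> {}"
      using norm_axis_1[of undefined] by (metis empty_iff mem_sphere_0)
    show "continuous_on (sphere 0 1) (\<lambda>y. norm (S *v y))"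
      by (intro continuous_on_norm linear_continuous_on) simp
  qed simp
  then obtain u :: "real^'l" where u: "norm u = 1" and max: "\<And>y. norm y = 1 \<Longrightarrow> norm (S *v y) \<le> norm (S *v u)"
    by auto
  have "\<sigma> \<le> norm (S *v u)" unfolding \<sigma>_def
  proof (rule onorm_bound)
    fix x show "norm (S *v x) \<le> norm (S *v u) * norm x"
    proof (cases "x = 0")
      case False
      then show ?thesis
        using max[of "inverse (norm x) *\<^sub>R x"] by (simp add: matrix_vector_mult_scaleR field_simps)
    qed simp
  qed simp
  then have nSu: "norm (S *v u) = \<sigma>"
    using norm_matrix_vector_le[of S u] u by (simp add: \<sigma>_def)
  then have SuSu: "(S *v u) \<bullet> (S *v u) = \<sigma>\<^sup>2"
    by (simp add: power2_norm_eq_inner[symmetric])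
  let ?t = "transpose S *v (S *v u)"
  have tu: "?t \<bullet> u = \<sigma>\<^sup>2"
    using SuSu by (simp add: inner_matrix_vector)
  \<comment> \<open>Equality case of Cauchy-Schwarz: \<open>?t\<close> has length at most
    \<open>\<sigma>\<^sup>2\<close> and inner product \<open>\<sigma>\<^sup>2\<close> with the unit
    vector \<open>u\<close>, so its distance from \<open>\<sigma>\<^sup>2 u\<close>
    vanishes.\<close>
  have "norm ?t \<le> \<sigma> * \<sigma>"
    using norm_matrix_vector_le[of "transpose S" "S *v u"] by (simp add: nSu \<sigma>_def)
  then have "?t \<bullet> ?t \<le> (\<sigma> * \<sigma>)\<^sup>2"
    by (simp add: power_mono flip: power2_norm_eq_inner)
  moreover have "(?t - \<sigma>\<^sup>2 *\<^sub>R u) \<bullet> (?t - \<sigma>\<^sup>2 *\<^sub>R u) = ?t \<bullet> ?t - 2 * \<sigma>\<^sup>2 * (?t \<bullet> u) + \<sigma>^4 * (u \<bullet> u)"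
    by (simp add: inner_diff_left inner_diff_right inner_commute power2_eq_square power4_eq_xxxx algebra_simps)
  ultimately have "(?t - \<sigma>\<^sup>2 *\<^sub>R u) \<bullet> (?t - \<sigma>\<^sup>2 *\<^sub>R u) \<le> 0"
    using u by (simp add: tu norm_eq_1 power2_eq_square power4_eq_xxxx)
  then have t: "?t = \<sigma>\<^sup>2 *\<^sub>R u"
    by (metis eq_iff_diff_eq_0 inner_eq_zero_iff inner_ge_zero order_antisym)
  \<comment> \<open>Pairing \<open>S u\<close> with \<open>?R u\<close> separates the quadratic
    forms of \<open>B\<close> and \<open>C\<close>, because
    \<open>S\<^sup>T S u = \<sigma>\<^sup>2 u\<close>.\<close>
  have "(b - c) * \<sigma>\<^sup>2 \<le> \<sigma>\<^sup>2 * (u \<bullet> (B *v u)) - (S *v u) \<bullet> (C *v (S *v u))"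
    using mult_left_mono[OF B[of u], of "\<sigma>\<^sup>2"] C[of "S *v u"] u
    by (simp add: SuSu norm_eq_1 algebra_simps)
  also have "\<dots> = (S *v u) \<bullet> (?R *v u)"
    using inner_matrix_vector[of "S *v u" S "B *v u"]
    by (simp add: t inner_diff_right matrix_vector_mult_diff_rdistrib flip: matrix_vector_mul_assoc)
  also have "\<dots> \<le> \<sigma> * spectral_norm ?R"
  proof -
    have "(S *v u) \<bullet> (?R *v u) \<le> \<sigma> * norm (?R *v u)"
      using norm_cauchy_schwarz[of "S *v u" "?R *v u"] by (simp only: nSu)
    also have "\<dots> \<le> \<sigma> * spectral_norm ?R"
      using norm_matrix_vector_le[of ?R u] u by (intro mult_left_mono) (simp_all add: \<sigma>_def)
    finally show ?thesis .
  qed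
  finally have "\<sigma> * ((b - c) * \<sigma>) \<le> \<sigma> * spectral_norm ?R"
    by (simp add: power2_eq_square algebra_simps)
  moreover have "0 \<le> \<sigma>" by (simp add: \<sigma>_def)
  ultimately show ?thesis
    by (cases "\<sigma> = 0") (simp_all add: mult_le_cancel_left_pos flip: \<sigma>_def)
qed


section \<open>Traces, reflections and the orthogonal Procrustes problem\<close>

lemma trace_transpose_self: "trace (transpose (B::real^'l^'m) ** B) = (\<Sum>i\<in>UNIV. \<Sum>j\<in>UNIV. (B $ i $ j)\<^sup>2)"
  unfolding trace_def matrix_matrix_mult_def transpose_def
  by (simp add: power2_eq_square) (rule sum.swap)

lemma frobenius_norm_sq: "(frobenius_norm (B::real^'l^'m))\<^sup>2 = trace (transpose B ** B)"
  by (simp add: frobenius_norm_def trace_transpose_self sum_nonneg)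

lemma trace_transpose_self_eq_0: "trace (transpose (B::real^'l^'m) ** B) = 0 \<Longrightarrow> B = 0"
  by (simp add: trace_transpose_self sum_nonneg sum_nonneg_eq_0_iff vec_eq_iff)

definition outer :: "real^'m \<Rightarrow> real^'l \<Rightarrow> real^'l^'m" where
  "outer u w = (\<chi> i j. u $ i * w $ j)"

lemma outer_mult_vec: "outer u w *v x = (w \<bullet> x) *\<^sub>R u"
  by (simp add: outer_def matrix_vector_mult_def vec_eq_iff inner_vec_def sum_distrib_right sum_distrib_left algebra_simps)

lemma mult_outer: "(A::real^'l^'m) ** outer u w = outer (A *v u) w"
  by (simp add: matrix_eq outer_mult_vec matrix_vector_mult_scaleR flip: matrix_vector_mul_assoc)

lemma outer_mult: "outer u w ** (A::real^'l^'m) = outer u (transpose A *v w)"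
  by (simp add: matrix_eq outer_mult_vec inner_matrix_vector flip: matrix_vector_mul_assoc)

lemma trace_outer: "trace (outer u w) = u \<bullet> w"
  by (simp add: trace_def outer_def inner_vec_def)

text \<open>The reflection along \<open>v\<close>. Dividing by \<open>v \<bullet> v\<close> makes it
  available for vectors of any length; for \<open>v = 0\<close> the quotient is \<open>0\<close> and
  the matrix is the identity, so it is orthogonal in every case.\<close>

definition householder :: "real^'m \<Rightarrow> real^'m^'m" where
  "householder v = mat 1 - outer v ((2 / (v \<bullet> v)) *\<^sub>R v)"

lemma orthogonal_householder: "orthogonal_matrix (householder v)"
proof -
  have "transpose (householder v) = householder v"
    by (simp add: householder_def outer_def transpose_def vec_eq_iff mat_def algebra_simps)
  moreover have "householder v ** householder v = mat 1"
  proof (cases "v = 0")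
    case True
    then show ?thesis by (simp add: householder_def matrix_eq outer_mult_vec matrix_vector_mult_diff_rdistrib
          flip: matrix_vector_mul_assoc)
  next
    case False
    then show ?thesis
      by (simp add: householder_def matrix_eq outer_mult_vec inner_diff_right field_simps 
          matrix_vector_mult_diff_rdistrib matrix_vector_mult_diff_distrib matrix_vector_mult_scaleR 
          flip: matrix_vector_mul_assoc scaleR_left_distrib)
  qed
  ultimately show ?thesis
    by (simp add: orthogonal_matrix)
qed

lemma trace_mult_householder:
  "trace ((C::real^'m^'m) ** householder v) = trace C - 2 / (v \<bullet> v) * (v \<bullet> (C *v v))"
  by (simp add: householder_def matrix_diff_ldistrib mult_outer trace_sub trace_outer inner_commute)

text \<open>Composition with the reflection along \<open>x\<close> lowers the trace by
  \<open>2 (x \<bullet> C x) / (x \<bullet> x)\<close>; by maximality this amount cannot be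
  negative.\<close>

lemma trace_maximal_imp_psd:
  fixes C :: "real^'m^'m"
  assumes max: "\<And>Q. orthogonal_matrix Q \<Longrightarrow> trace (C ** Q) \<le> trace C"
  shows "0 \<le> x \<bullet> (C *v x)"
proof (cases "x = 0")
  case False
  then have "0 < x \<bullet> x" by simp
  then show ?thesis
    using max[OF orthogonal_householder[of x]]
    unfolding trace_mult_householder by (simp add: zero_le_divide_iff del: inner_gt_zero_iff)
qed simp

text \<open>Testing against products of two reflections, i.e. rotations by a small angle, gives symmetry.\<close>

lemma trace_maximal_imp_symmetric:
  fixes C :: "real^'m^'m"
  assumes max: "\<And>Q. orthogonal_matrix Q \<Longrightarrow> trace (C ** Q) \<le> trace C"
  shows "transpose C = C"
proof -
  have "C $ j $ i = C $ i $ j" if "i \<noteq> j" for i j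
  proof -
    let ?b = "C $ j $ i - C $ i $ j" and ?k = "C $ i $ i + C $ j $ j"
    have e: "axis a 1 \<bullet> (C *v axis b 1) = C $ a $ b" for a b
      by (simp add: inner_axis' matrix_vector_mult_basis column_def)
    have k: "0 \<le> ?k"
      using trace_maximal_imp_psd[OF max, of "axis i 1"] trace_maximal_imp_psd[OF max, of "axis j 1"]
      by (simp add: e)
    \<comment> \<open>The rotation below changes the trace by
      \<open>2 (t ?b - t\<^sup>2 ?k) / (1 + t\<^sup>2)\<close>. For small \<open>t\<close> the
      linear term dominates, so validity for all real \<open>t\<close> forces
      \<open>?b = 0\<close>.\<close>
    have le: "t * ?b \<le> t\<^sup>2 * ?k" for t
    proof -
      \<comment> \<open>The reflections along \<open>axis i 1\<close> and \<open>w\<close> compose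
        to a rotation of the plane of the coordinates \<open>i\<close> and \<open>j\<close>, by
        twice the angle between these vectors; that angle has tangent
        \<open>\<bar>t\<bar>\<close>.\<close>
      define w where "w = axis i 1 + t *\<^sub>R axis j (1::real)"
      have ee: "axis i 1 \<bullet> axis i (1::real) = 1" "axis j 1 \<bullet> axis j (1::real) = 1"
        "axis i 1 \<bullet> axis j (1::real) = 0" "axis j 1 \<bullet> axis i (1::real) = 0"
        using that by (auto simp: inner_axis_axis)
      have w: "w \<bullet> w = 1 + t\<^sup>2" "axis i 1 \<bullet> w = 1"
        by (simp_all add: w_def inner_add_left inner_add_right ee power2_eq_square)
      have wC: "w \<bullet> (C *v w) = C $ i $ i + t * (C $ i $ j + C $ j $ i) + t\<^sup>2 * C $ j $ j"
        "w \<bullet> (C *v axis i 1) = C $ i $ i + t * C $ j $ i"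
        by (simp_all add: w_def inner_add_left inner_add_right e matrix_vector_right_distrib
            matrix_vector_mult_scaleR power2_eq_square algebra_simps)
      have pos: "0 < 1 + t\<^sup>2" by (simp add: add_pos_nonneg)
      have "trace (C ** (householder (axis i 1) ** householder w)) \<le> trace C"
        by (intro max orthogonal_matrix_mul orthogonal_householder)
      then have "trace ((C ** householder (axis i 1)) ** householder w) \<le> trace C"
        by (simp add: matrix_mul_assoc)
      also have "trace ((C ** householder (axis i 1)) ** householder w)
        = trace C - 2 * C $ i $ i - 2 / (1 + t\<^sup>2) * (w \<bullet> (C *v w) - 2 * (w \<bullet> (C *v axis i 1)))"
      proof -
        have "householder (axis i 1) *v w = w - 2 *\<^sub>R axis i 1"
          by (simp add: householder_def matrix_vector_mult_diff_rdistrib outer_mult_vec ee w)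
        then show ?thesis
          unfolding trace_mult_householder w ee e
          by (simp add: matrix_vector_mult_diff_distrib matrix_vector_mult_scaleR inner_diff_right
              flip: matrix_vector_mul_assoc)
      qed
      finally have "0 \<le> (1 + t\<^sup>2) * C $ i $ i + (w \<bullet> (C *v w) - 2 * (w \<bullet> (C *v axis i 1)))"
        using pos by (simp add: field_simps)
      then show ?thesis by (simp add: wC algebra_simps)
    qed
    \<comment> \<open>Adding \<open>1\<close> keeps the denominator positive even for
      \<open>?k = 0\<close>. The inequality then reads
      \<open>t\<^sup>2 (?k + 1) \<le> t\<^sup>2 ?k\<close>, which leaves only
      \<open>t = 0\<close>.\<close>
    define t where "t = ?b / (?k + 1)"
    have b: "?b = t * (?k + 1)" using k by (simp add: t_def)
    have "t * (t * (?k + 1)) \<le> t\<^sup>2 * ?k" using le[of t] unfolding b .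
    then have "t\<^sup>2 \<le> 0" by (simp add: algebra_simps power2_eq_square)
    then show ?thesis using b by simp
  qed
  then show ?thesis
    by (simp add: transpose_def vec_eq_iff) metis
qed

text \<open>In the squared Frobenius distance only the cross term depends on the orthogonal factor,
  so minimising the distance means maximising a trace; \<open>U ** Q\<close> is again an admissible
  factor.\<close>

lemma procrustes_trace_maximal:
  fixes Vh V :: "real^'l^'m"
  assumes Vh: "orthonormal_columns Vh"
    and U: "is_arg_min (\<lambda>U. frobenius_norm (Vh ** U - V)) orthogonal_matrix U"
    and Q: "orthogonal_matrix Q"
  shows "trace (transpose V ** (Vh ** U) ** Q) \<le> trace (transpose V ** (Vh ** U))"
proof -
  have expand: "(frobenius_norm (Vh ** R - V))\<^sup>2
      = trace (mat 1 :: real^'l^'l) + trace (transpose V ** V) - 2 * trace (transpose V ** (Vh ** R))"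
    if "orthogonal_matrix R" for R
  proof -
    have "transpose (Vh ** R) ** (Vh ** R) = transpose R ** (transpose Vh ** Vh) ** R"
      by (simp add: matrix_transpose_mul matrix_mul_assoc)
    then have 1: "transpose (Vh ** R) ** (Vh ** R) = mat 1"
      using Vh that by (simp add: orthonormal_columns_def orthogonal_matrix)
    have "trace (transpose (Vh ** R) ** V) = trace (transpose (transpose (Vh ** R) ** V))"
      by (simp add: trace_def transpose_def)
    then have 2: "trace (transpose (Vh ** R) ** V) = trace (transpose V ** (Vh ** R))"
      by (simp add: matrix_transpose_mul[of "transpose (Vh ** R)"])
    show ?thesis
      unfolding frobenius_norm_sq transpose_diff matrix_diff_ldistrib matrix_diff_rdistrib trace_sub 1 2
      by simp
  qed
  have oU: "orthogonal_matrix U" and oUQ: "orthogonal_matrix (U ** Q)"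
    using U Q by (auto simp: is_arg_min_def intro: orthogonal_matrix_mul)
  then have "frobenius_norm (Vh ** U - V) \<le> frobenius_norm (Vh ** (U ** Q) - V)"
    using U by (force simp: is_arg_min_def)
  then have "(frobenius_norm (Vh ** U - V))\<^sup>2 \<le> (frobenius_norm (Vh ** (U ** Q) - V))\<^sup>2"
    by (intro power_mono) (simp_all add: frobenius_norm_def sum_nonneg)
  then show ?thesis
    by (simp add: expand[OF oU] expand[OF oUQ] del: matrix_mul_assoc) (simp add: matrix_mul_assoc)
qed

section \<open>Orthonormal bases and Rayleigh quotients\<close>

text \<open>The sum \<open>P\<close> of the two projections is symmetric and idempotent with trace
  equal to the full dimension, so \<open>mat 1 - P\<close> has Frobenius norm zero.\<close>

lemma orthonormal_columns_complete:
  fixes V1 :: "real^'r^'n" and V2 :: "real^'s^'n"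
  assumes V1: "orthonormal_columns V1" and V2: "orthonormal_columns V2"
    and V12: "transpose V1 ** V2 = 0" and card: "CARD('r) + CARD('s) = CARD('n)"
  shows "V1 ** transpose V1 + V2 ** transpose V2 = mat 1"
proof -
  have V21: "transpose V2 ** V1 = 0"
    using arg_cong[OF V12, of transpose] by (simp add: matrix_transpose_mul)
  let ?P = "V1 ** transpose V1 + V2 ** transpose V2"
  have mm: "A ** transpose B ** C ** transpose D = A ** (transpose B ** C) ** transpose D"
    for A :: "real^'k^'n" and B :: "real^'k^'n" and C :: "real^'q^'n" and D :: "real^'q^'n"
    by (simp add: matrix_mul_assoc)
  have PP: "?P ** ?P = ?P"
    using V1 V2 by (simp add: matrix_add_ldistrib matrix_add_rdistrib matrix_mul_assoc mm V12 V21 orthonormal_columns_def)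
  have PT: "transpose ?P = ?P"
    by (simp add: transpose_add matrix_transpose_mul)
  have "trace ?P = trace (mat 1 :: real^'n^'n)"
    using V1 V2 card by (simp add: trace_add trace_mul_sym[of V1] trace_mul_sym[of V2] orthonormal_columns_def trace_I flip: of_nat_add)
  then have "trace (transpose (mat 1 - ?P) ** (mat 1 - ?P)) = 0"
    by (simp add: transpose_diff PT matrix_diff_ldistrib matrix_diff_rdistrib PP trace_sub)
  then show ?thesis
    using trace_transpose_self_eq_0 by fastforce
qed


text \<open>Dimension count: the orthogonal complement of \<open>B\<close> has codimension at most
  \<open>card B\<close>, hence meets \<open>T\<close> in more than the origin.\<close>

lemma exists_orthogonal_in_subspace:
  fixes T :: "'a::euclidean_space set"
  assumes T: "subspace T" and B: "finite B" "card B < dim T"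
  obtains x where "x \<in> T" "x \<noteq> 0" "\<And>b. b \<in> B \<Longrightarrow> x \<bullet> b = 0"
proof -
  let ?N = "{y \<in> UNIV. \<forall>x\<in>span B. orthogonal x y}"
  have N: "subspace ?N"
    by (auto simp: subspace_def orthogonal_clauses)
  have "dim ?N + dim (span B) = dim (UNIV :: 'a set)"
    by (rule dim_subspace_orthogonal_to_vectors) auto
  moreover have "dim (span B) \<le> card B"
    using B by (simp add: dim_le_card')
  moreover have "dim {x + y |x y. x \<in> T \<and> y \<in> ?N} + dim (T \<inter> ?N) = dim T + dim ?N"
    by (rule dim_sums_Int[OF T N])
  moreover have "dim {x + y |x y. x \<in> T \<and> y \<in> ?N} \<le> dim (UNIV :: 'a set)"
    by (rule dim_subset) simp
  ultimately have "dim (T \<inter> ?N) \<noteq> 0" using B by linarith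
  then obtain x where x: "x \<in> T \<inter> ?N" "x \<noteq> 0"
    unfolding dim_eq_0 by blast
  show thesis
    using x by (intro that[of x]) (auto simp: orthogonal_def inner_commute intro: span_base)
qed

text \<open>Orthonormality makes the \<open>DIM('a)\<close> vectors distinct and independent, hence
  a basis; distinctness also allows summing over indices instead of vectors.\<close>

lemma orthonormal_family_expansion:
  fixes v :: "nat \<Rightarrow> 'a::euclidean_space"
  assumes v: "\<forall>i\<in>{1..DIM('a)}. \<forall>j\<in>{1..DIM('a)}. v i \<bullet> v j = (if i = j then 1 else 0)"
  shows "x = (\<Sum>i\<in>{1..DIM('a)}. (x \<bullet> v i) *\<^sub>R v i)"
proof -
  let ?I = "{1..DIM('a)}"
  have inj: "inj_on v ?I"
    using v by (metis inj_onI zero_neq_one)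
  have po: "pairwise orthogonal (v ` ?I)"
    using v unfolding pairwise_image by (auto simp: pairwise_def orthogonal_def)
  moreover have "0 \<notin> v ` ?I"
    using v by force
  ultimately have ind: "independent (v ` ?I)"
    by (rule pairwise_orthogonal_independent)
  have "span (v ` ?I) = UNIV"
    using ind dim_eq_full[of "v ` ?I"] card_image[OF inj] by (simp add: dim_eq_card_independent)
  moreover have "norm b = 1" if "b \<in> v ` ?I" for b
    using v that by (auto simp: norm_eq_1)
  ultimately have "(\<Sum>i\<in>v ` ?I. (x \<bullet> i) *\<^sub>R i) = x"
    by (intro orthonormal_basis_expand[OF po]) auto
  then show ?thesis
    by (simp only: sum.reindex[OF inj] o_def)
qed

text \<open>\<open>\<mu>\<close> is the \<open>k\<close>-th largest eigenvalue; its upper bound by any \<open>k\<close>-dimensional subspace is one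
  half of the Courant--Fischer principle.\<close>

lemma dominant_invariant_subspace_rayleigh:
  fixes M :: "real^'n^'n"
  assumes dom: "dominant_invariant_subspace k M S" and k: "1 \<le> k"
  obtains \<mu> where "\<And>x. x \<in> S \<Longrightarrow> M *v x \<in> S"
    and "\<And>x. x \<in> S \<Longrightarrow> \<mu> * (x \<bullet> x) \<le> x \<bullet> (M *v x)"
    and "\<And>T. subspace T \<Longrightarrow> k \<le> dim T \<Longrightarrow> \<exists>x\<in>T. x \<noteq> 0 \<and> x \<bullet> (M *v x) \<le> \<mu> * (x \<bullet> x)"
proof -
  let ?I = "{1..CARD('n)}"
  obtain m v where kn: "k \<le> CARD('n)"
    and v: "\<forall>i\<in>?I. \<forall>j\<in>?I. v i \<bullet> v j = (if i = j then 1 else 0)"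
    and eig: "\<forall>i\<in>?I. M *v v i = m i *\<^sub>R v i"
    and mono: "\<forall>i\<in>?I. \<forall>j\<in>?I. i \<le> j \<longrightarrow> m j \<le> m i"
    and S: "S = span (v ` {1..k})"
    using dom unfolding dominant_invariant_subspace_def by blast
  have expand: "x = (\<Sum>i\<in>?I. (x \<bullet> v i) *\<^sub>R v i)" for x
    using orthonormal_family_expansion[of v x] v by simp
  have Mx: "M *v x = (\<Sum>i\<in>?I. (x \<bullet> v i) *\<^sub>R (m i *\<^sub>R v i))" for x
  proof -
    have "M *v x = M *v (\<Sum>i\<in>?I. (x \<bullet> v i) *\<^sub>R v i)" by (simp only: expand[symmetric])
    also have "\<dots> = (\<Sum>i\<in>?I. M *v ((x \<bullet> v i) *\<^sub>R v i))"
      by (rule linear_sum) simp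
    also have "\<dots> = (\<Sum>i\<in>?I. (x \<bullet> v i) *\<^sub>R (m i *\<^sub>R v i))"
      using eig by (intro sum.cong) (simp_all add: matrix_vector_mult_scaleR)
    finally show ?thesis .
  qed
  have quad: "x \<bullet> (M *v x) = (\<Sum>i\<in>?I. m i * (x \<bullet> v i)\<^sup>2)" for x
    by (simp add: Mx inner_sum_right power2_eq_square mult_ac)
  have norm: "x \<bullet> x = (\<Sum>i\<in>?I. (x \<bullet> v i)\<^sup>2)" for x
  proof -
    have "x \<bullet> x = x \<bullet> (\<Sum>i\<in>?I. (x \<bullet> v i) *\<^sub>R v i)" by (simp only: expand[symmetric])
    then show ?thesis by (simp add: inner_sum_right power2_eq_square)
  qed
  show thesis
  proof (rule that[of "m k"])
    fix x assume "x \<in> S"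
    then have x: "x \<in> span (v ` {1..k})" by (simp add: S)
    \<comment> \<open>On \<open>S\<close> the coordinates beyond \<open>k\<close> vanish, and the
      eigenvalues of the others are at least \<open>m k\<close>.\<close>
    have "x \<bullet> v j = 0" if "j \<in> ?I" "k < j" for j
      using x
    proof (rule span_induct)
      show "subspace {x. x \<bullet> v j = 0}" by (auto simp: subspace_def inner_add_left)
      fix y assume "y \<in> v ` {1..k}"
      then show "y \<bullet> v j = 0" using v that kn by auto
    qed
    then have "m k * (x \<bullet> v i)\<^sup>2 \<le> m i * (x \<bullet> v i)\<^sup>2" if "i \<in> ?I" for i
      using mono that k kn by (cases "i \<le> k") (auto intro!: mult_right_mono)
    then show "m k * (x \<bullet> x) \<le> x \<bullet> (M *v x)"
      unfolding quad norm sum_distrib_left by (rule sum_mono)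
    show "M *v x \<in> S"
      using x unfolding S
    proof (rule span_induct)
      show "subspace {x. M *v x \<in> span (v ` {1..k})}"
        by (auto simp: subspace_def matrix_vector_right_distrib matrix_vector_mult_scaleR span_add span_scale span_zero)
      fix y assume y: "y \<in> v ` {1..k}"
      then obtain i where "i \<in> {1..k}" "y = v i"
        by blast
      then have "M *v y = m i *\<^sub>R y"
        using eig kn by simp
      then show "M *v y \<in> span (v ` {1..k})"
        using y by (simp add: span_scale span_base)
    qed
  next
    fix T :: "(real^'n) set"
    assume T: "subspace T" "k \<le> dim T"
    \<comment> \<open>Only the first \<open>k - 1\<close> eigenvectors are avoided, so
      \<open>T\<close> still contains a nonzero vector orthogonal to them; its other coordinates
      belong to eigenvalues at most \<open>m k\<close>.\<close>
    have "card (v ` {1..<k}) \<le> card {1..<k}" by (rule card_image_le) simp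
    then have "card (v ` {1..<k}) < dim T" using T k by simp
    then obtain x where x: "x \<in> T" "x \<noteq> 0" "\<And>b. b \<in> v ` {1..<k} \<Longrightarrow> x \<bullet> b = 0"
      using exists_orthogonal_in_subspace[OF T(1), of "v ` {1..<k}"] by auto
    have "m i * (x \<bullet> v i)\<^sup>2 \<le> m k * (x \<bullet> v i)\<^sup>2" if "i \<in> ?I" for i
      using x(3)[of "v i"] mono that k kn by (cases "i < k") (auto intro!: mult_right_mono)
    then have "x \<bullet> (M *v x) \<le> m k * (x \<bullet> x)"
      unfolding quad norm sum_distrib_left by (rule sum_mono)
    then show "\<exists>x\<in>T. x \<noteq> 0 \<and> x \<bullet> (M *v x) \<le> m k * (x \<bullet> x)"
      using x by auto
  qed
qed

section \<open>Estimates involving the separations\<close>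

lemma spectral_norm_outer_axis: "spectral_norm (outer (axis j 1) (axis i 1) :: real^'l^'m) = 1"
proof (rule antisym)
  show "spectral_norm (outer (axis j 1) (axis i 1) :: real^'l^'m) \<le> 1"
    by (rule onorm_bound) (auto simp: outer_mult_vec inner_axis' component_le_norm_cart)
  show "1 \<le> spectral_norm (outer (axis j 1) (axis i 1) :: real^'l^'m)"
    using norm_matrix_vector_le[of "outer (axis j 1) (axis i 1) :: real^'l^'m" "axis i 1"]
    by (simp add: outer_mult_vec inner_axis_axis)
qed

text \<open>A matrix unit is an eigenvector of the Sylvester operator of two diagonal matrices, with
  eigenvalue \<open>d i - c j\<close>, and has norm one; it therefore competes in the
  infimum.\<close>

lemma sep_spectral_norm_diag_le:
  "sep spectral_norm (diag_mat d) (diag_mat c) \<le> \<bar>d i - c j\<bar>"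
proof -
  let ?Z = "outer (axis j 1) (axis i 1) :: real^'a^'b"
  have d: "diag_mat d *v axis i 1 = d i *\<^sub>R axis i 1" for d :: "'q::finite \<Rightarrow> real" and i
    by (simp add: diag_mat_mult_vec vec_eq_iff axis_def)
  have t: "transpose (diag_mat d) = diag_mat d" for d :: "'q::finite \<Rightarrow> real"
    by (simp add: diag_mat_def transpose_def vec_eq_iff)
  have eq: "?Z ** diag_mat d - diag_mat c ** ?Z = (d i - c j) *\<^sub>R ?Z"
    unfolding mult_outer outer_mult t d
    by (simp add: outer_def vec_eq_iff algebra_simps)
  have "spectral_norm ((d i - c j) *\<^sub>R ?Z) = \<bar>d i - c j\<bar> * spectral_norm ?Z"
    using onorm_scaleR[of "(*v) ?Z" "d i - c j"] by (simp add: scaleR_matrix_vector_assoc)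
  then have "spectral_norm (?Z ** diag_mat d - diag_mat c ** ?Z) = \<bar>d i - c j\<bar>"
    unfolding eq by (simp add: spectral_norm_outer_axis)
  moreover have "sep spectral_norm (diag_mat d) (diag_mat c) \<le> spectral_norm (?Z ** diag_mat d - diag_mat c ** ?Z)"
    unfolding sep_def
    by (intro cInf_lower bdd_belowI[of _ 0]) (auto intro!: exI[of _ ?Z] simp: spectral_norm_outer_axis)
  ultimately show ?thesis by simp
qed

text \<open>By homogeneity \<open>Z\<close> may be scaled to norm one, where it competes in the
  infimum; the zero matrix cannot be scaled and is treated apart.\<close>

lemma sep_in_two_inf_norm_le:
  assumes Z: "\<forall>j. column j Z \<in> range ((*v) W)"
  shows "sep_in two_inf_norm W B C * two_inf_norm Z \<le> two_inf_norm (Z ** B - C ** Z)"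
proof (cases "Z = 0")
  case True
  then have "two_inf_norm Z = 0" using two_inf_norm_scaleR[of 0 Z] by simp
  then show ?thesis by simp
next
  case False
  let ?n = "two_inf_norm Z"
  have pos: "?n > 0"
    using False two_inf_norm_eq_0[of Z] two_inf_norm_nonneg[of Z] by linarith
  define Y where "Y = inverse ?n *\<^sub>R Z"
  have col: "column j Y \<in> range ((*v) W)" for j
  proof -
    obtain x where "column j Z = W *v x" using Z by auto
    then have "column j Y = W *v (inverse ?n *\<^sub>R x)"
      by (simp add: Y_def column_def matrix_vector_mult_scaleR vec_eq_iff)
    then show ?thesis by simp
  qed
  have nY: "two_inf_norm Y = 1"
    using pos by (simp add: Y_def two_inf_norm_scaleR)
  have eq: "Y ** B - C ** Y = inverse ?n *\<^sub>R (Z ** B - C ** Z)"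
    by (simp add: Y_def scalar_matrix_assoc matrix_scalar_ac algebra_simps)
  have "sep_in two_inf_norm W B C \<le> two_inf_norm (Y ** B - C ** Y)"
    unfolding sep_in_def
    by (intro cInf_lower bdd_belowI[of _ 0]) (auto intro!: exI[of _ Y] simp: col nY)
  also have "\<dots> = two_inf_norm (Z ** B - C ** Z) / ?n"
    using pos unfolding eq by (simp add: two_inf_norm_scaleR divide_inverse)
  finally show ?thesis
    using pos by (simp add: field_simps)
qed


section \<open>The near-identity block, eigenvector blocks and the Riccati equation\<close>

lemma spectral_norm_diff_mat_1_le:
  fixes C :: "real^'l^'l" and S :: "real^'l^'m"
  assumes sym: "transpose C = C" and psd: "\<And>x. 0 \<le> x \<bullet> (C *v x)"
    and CS: "transpose C ** C + transpose S ** S = mat 1"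
  shows "spectral_norm (C - mat 1) \<le> (spectral_norm S)\<^sup>2"
proof (rule onorm_bound)
  fix x
  define y where "y = (C - mat 1) *v x"
  have "y + C *v y = - (transpose S *v (S *v x))"
  proof -
    have "C *v (C *v x) + transpose S *v (S *v x) = x"
      using arg_cong[OF CS, of "\<lambda>B. B *v x"]
      by (simp add: sym matrix_vector_mult_add_rdistrib flip: matrix_vector_mul_assoc)
    then show ?thesis
      by (simp add: y_def algebra_simps eq_neg_iff_add_eq_0)
  qed
  moreover have "norm y \<le> norm (y + C *v y)"
  proof (cases "y = 0")
    case False
    have "norm y * norm y \<le> y \<bullet> (y + C *v y)"
      using psd[of y] by (simp add: inner_add_right dot_square_norm power2_eq_square)
    also have "\<dots> \<le> norm y * norm (y + C *v y)"
      by (rule norm_cauchy_schwarz)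
    finally show ?thesis using False by simp
  qed simp
  moreover have "norm (transpose S *v (S *v x)) \<le> (spectral_norm S)\<^sup>2 * norm x"
  proof -
    have "norm (transpose S *v (S *v x)) \<le> spectral_norm S * norm (S *v x)"
      using norm_matrix_vector_le[of "transpose S"] by simp
    also have "\<dots> \<le> spectral_norm S * (spectral_norm S * norm x)"
      by (intro mult_left_mono norm_matrix_vector_le spectral_norm_nonneg)
    finally show ?thesis by (simp add: power2_eq_square algebra_simps)
  qed
  ultimately show "norm ((C - mat 1) *v x) \<le> (spectral_norm S)\<^sup>2 * norm x"
    by (simp add: y_def)
qed simp

text \<open>The triangle inequality bounds \<open>norm (C x)\<close> below by
  \<open>(1 - q) norm x\<close>. This gives injectivity, hence a two-sided inverse, and the bound on
  it.\<close>

lemma inverse_near_mat_1: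
  fixes C :: "real^'l^'l"
  assumes C: "spectral_norm (C - mat 1) \<le> q" and q: "q < 1"
  obtains D where "C ** D = mat 1" "D ** C = mat 1" "spectral_norm D \<le> 1 / (1 - q)"
proof -
  have low: "(1 - q) * norm x \<le> norm (C *v x)" for x
  proof -
    have "norm ((C - mat 1) *v x) \<le> q * norm x"
      using norm_matrix_vector_le[of "C - mat 1" x] C by (meson mult_right_mono norm_ge_zero order_trans)
    moreover have "norm x \<le> norm (C *v x) + norm ((C - mat 1) *v x)"
      using norm_triangle_ineq4[of "C *v x" "(C - mat 1) *v x"] by (simp add: matrix_vector_mult_diff_rdistrib)
    ultimately show ?thesis by (simp add: algebra_simps)
  qed
  have "C *v x = 0 \<Longrightarrow> x = 0" for x
    using low[of x] q by (simp add: mult_le_0_iff)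
  then obtain D where D: "D ** C = mat 1"
    using matrix_left_invertible_ker[of C] by blast
  then have CD: "C ** D = mat 1" by (simp add: matrix_left_right_inverse)
  have "spectral_norm D \<le> 1 / (1 - q)"
  proof (rule onorm_bound)
    fix z show "norm (D *v z) \<le> 1 / (1 - q) * norm z"
      using low[of "D *v z"] q by (simp add: matrix_vector_mul_assoc CD field_simps)
  qed (use q in simp)
  then show thesis using that CD D by blast
qed

lemma diag_mat_quadratic: "x \<bullet> (diag_mat d *v x) = (\<Sum>i\<in>UNIV. d i * (x $ i)\<^sup>2)"
  by (simp add: diag_mat_mult_vec inner_vec_def power2_eq_square mult_ac)

lemma inner_eq_sum_squares: "x \<bullet> x = (\<Sum>i\<in>UNIV. ((x::real^'l) $ i)\<^sup>2)"
  by (simp add: inner_vec_def power2_eq_square)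

lemma orthonormal_columns_mult_orthogonal:
  assumes "orthonormal_columns (V::real^'l^'m)" "orthogonal_matrix U"
  shows "orthonormal_columns (V ** U)"
proof -
  have "transpose (V ** U) ** (V ** U) = transpose U ** (transpose V ** V) ** U"
    by (simp add: matrix_transpose_mul matrix_mul_assoc)
  then show ?thesis
    using assms by (simp add: orthonormal_columns_def orthogonal_matrix)
qed

lemma dim_range_orthonormal_columns:
  assumes "orthonormal_columns (V::real^'l^'m)" shows "dim (range ((*v) V)) = CARD('l)"
proof -
  have "inj ((*v) V)"
    using assms unfolding orthonormal_columns_def
    by (metis injI matrix_vector_mul_assoc matrix_vector_mul_lid)
  then have "dim (range ((*v) V)) = dim (UNIV :: (real^'l) set)"
    by (intro dim_image_eq) (simp_all add: inj_on_subset)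
  then show ?thesis by simp
qed

text \<open>Evaluating \<open>x \<bullet> A y\<close> with \<open>A\<close> acting on either side
  shows that eigenvectors for distinct eigenvalues are orthogonal.\<close>

lemma eigenvector_matrices_orthogonal:
  fixes A :: "real^'n^'n" and V1 :: "real^'r^'n" and V2 :: "real^'s^'n"
  assumes sym: "transpose A = A"
    and 1: "\<And>i. A *v column i V1 = d1 i *\<^sub>R column i V1"
    and 2: "\<And>j. A *v column j V2 = d2 j *\<^sub>R column j V2"
    and ne: "\<And>i j. d1 i \<noteq> d2 j"
  shows "transpose V1 ** V2 = 0"
proof -
  have "column i V1 \<bullet> column j V2 = 0" for i j
  proof -
    have "d2 j * (column i V1 \<bullet> column j V2) = column i V1 \<bullet> (A *v column j V2)" by (simp add: 2)
    also have "\<dots> = d1 i * (column i V1 \<bullet> column j V2)" by (simp add: inner_matrix_vector sym 1)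
    finally show ?thesis using ne[of i j] by simp
  qed
  then show ?thesis
    by (simp add: matrix_matrix_mult_def transpose_def vec_eq_iff column_def inner_vec_def)
qed

lemma transpose_mult_decomposed:
  fixes V1 :: "real^'r^'n" and V2 :: "real^'s^'n"
  assumes "A = V1 ** L1 ** transpose V1 + V2 ** L2 ** transpose V2"
    and V1: "orthonormal_columns V1" and V12: "transpose V1 ** V2 = 0"
  shows "transpose V1 ** A = L1 ** transpose V1"
proof -
  have "transpose V1 ** A = (transpose V1 ** V1) ** L1 ** transpose V1 + (transpose V1 ** V2) ** L2 ** transpose V2"
    by (simp add: assms(1) matrix_add_ldistrib matrix_mul_assoc)
  then show ?thesis
    using V1 by (simp add: V12 orthonormal_columns_def)
qed

text \<open>If \<open>M W u = W z\<close>, then \<open>W\<^sup>T\<close> recovers the coordinates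
  \<open>z\<close>, so \<open>W\<^sup>T M W\<close> represents \<open>M\<close> on the range of
  \<open>W\<close>.\<close>

lemma invariant_range_mult:
  fixes W :: "real^'l^'m" and M :: "real^'m^'m"
  assumes W: "orthonormal_columns W" and inv: "\<And>u. M *v (W *v u) \<in> range ((*v) W)"
  shows "M ** W = W ** (transpose W ** M ** W)"
  unfolding matrix_eq
proof
  fix u
  obtain z where z: "M *v (W *v u) = W *v z" using inv by blast
  have "transpose W *v (W *v z) = z"
    using W by (simp add: matrix_vector_mul_assoc orthonormal_columns_def)
  then show "(M ** W) *v u = (W ** (transpose W ** M ** W)) *v u"
    using z by (simp flip: matrix_vector_mul_assoc)
qed

text \<open>With \<open>C\<close> and \<open>S\<close> the coordinates of an invariant subspace of \<open>A + E\<close> with respect to the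
  eigenvectors of \<open>A\<close>, the quotient \<open>X = S C\<^sup>-\<^sup>1\<close> solves an algebraic Riccati equation.\<close>

lemma riccati_of_invariant:
  fixes C D M L1 E11 :: "real^'r^'r" and S X :: "real^'r^'s"
  assumes eqC: "C ** M = L1 ** C + E11 ** C + E12 ** S"
    and eqS: "S ** M = L2 ** S + E21 ** C + E22 ** S"
    and D: "C ** D = mat 1" "D ** C = mat 1" and X: "X = S ** D"
  shows "X ** L1 - L2 ** X = E21 + E22 ** X - X ** E11 - X ** (E12 ** X)"
proof -
  have XC: "S = X ** C"
    using D by (simp add: X flip: matrix_mul_assoc)
  \<comment> \<open>Right multiplication by \<open>D\<close> turns both equations into equations for
    \<open>X\<close>; since \<open>X C = S\<close>, the product \<open>X (C M D)\<close> equals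
    \<open>S M D\<close>, and this eliminates \<open>M\<close>.\<close>
  have "C ** M ** D = L1 ** (C ** D) + E11 ** (C ** D) + E12 ** (S ** D)"
    by (simp add: eqC matrix_add_rdistrib matrix_mul_assoc)
  then have "C ** M ** D = L1 + E11 + E12 ** X"
    by (simp add: D X)
  then have "X ** (L1 + E11 + E12 ** X) = X ** (C ** M ** D)" by simp
  also have "\<dots> = S ** M ** D"
    by (simp add: XC matrix_mul_assoc)
  also have "\<dots> = L2 ** (S ** D) + E21 ** (C ** D) + E22 ** (S ** D)"
    by (simp add: eqS matrix_add_rdistrib matrix_mul_assoc)
  also have "\<dots> = L2 ** X + E21 + E22 ** X"
    by (simp add: D X)
  finally have "X ** L1 + X ** E11 + X ** (E12 ** X) = L2 ** X + E21 + E22 ** X"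
    by (simp add: matrix_add_ldistrib)
  then show ?thesis by (simp add: algebra_simps)
qed

text \<open>The columns of \<open>V2 X\<close> lie in the range of \<open>V2\<close>, so the
  restricted separation applies to them. The quantity being bounded recurs on the right, where a
  small coefficient allows it to be absorbed later.\<close>

lemma two_inf_norm_riccati_le:
  fixes V2 :: "real^'s^'n" and X E21 :: "real^'r^'s" and E12 :: "real^'s^'r"
  assumes V2: "orthonormal_columns V2"
    and ric: "X ** L1 - L2 ** X = E21 + E22 ** X - X ** E11 - X ** (E12 ** X)"
    and e: "spectral_norm E11 \<le> \<epsilon>" "spectral_norm E12 \<le> \<epsilon>"
  shows "sep_in two_inf_norm V2 L1 (V2 ** L2 ** transpose V2) * two_inf_norm (V2 ** X)
    \<le> two_inf_norm (V2 ** E21) + two_inf_norm (V2 ** E22 ** transpose V2) * spectral_norm X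
      + two_inf_norm (V2 ** X) * (\<epsilon> + \<epsilon> * spectral_norm X)"
proof -
  let ?Y = "V2 ** X" and ?G = "V2 ** E22 ** transpose V2"
  have VV: "transpose V2 ** (V2 ** B) = B" for B :: "real^'q^'s"
    using V2 by (simp add: matrix_mul_assoc orthonormal_columns_def)
  have "column j ?Y = V2 *v column j X" for j
    by (simp add: column_def vec_eq_iff matrix_matrix_mult_def matrix_vector_mult_def)
  then have "\<forall>j. column j ?Y \<in> range ((*v) V2)" by simp
  then have "sep_in two_inf_norm V2 L1 (V2 ** L2 ** transpose V2) * two_inf_norm ?Y
      \<le> two_inf_norm (?Y ** L1 - V2 ** L2 ** transpose V2 ** ?Y)"
    by (rule sep_in_two_inf_norm_le)
  also have "?Y ** L1 - V2 ** L2 ** transpose V2 ** ?Y = V2 ** (X ** L1 - L2 ** X)"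
    by (simp add: matrix_diff_ldistrib VV flip: matrix_mul_assoc)
  \<comment> \<open>Inserting \<open>V2\<^sup>T V2 = mat 1\<close> writes \<open>V2 E22 X\<close> as
    \<open>?G ** ?Y\<close>, which brings in the row norm of \<open>V2 E22 V2\<^sup>T\<close>; the
    last two terms keep \<open>?Y\<close> as left factor.\<close>
  also have "\<dots> = V2 ** E21 + ?G ** ?Y - ?Y ** E11 - ?Y ** (E12 ** X)"
    by (simp add: ric matrix_diff_ldistrib matrix_add_ldistrib VV flip: matrix_mul_assoc)
  also have "two_inf_norm \<dots> \<le> two_inf_norm (V2 ** E21) + two_inf_norm (?G ** ?Y)
      + two_inf_norm (?Y ** E11) + two_inf_norm (?Y ** (E12 ** X))"
    by (meson add_right_mono order_trans two_inf_norm_add_le two_inf_norm_diff_le)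
  also have "two_inf_norm (?G ** ?Y) \<le> two_inf_norm ?G * spectral_norm X"
  proof (rule two_inf_norm_mult_le_unit)
    show "spectral_norm ?Y \<le> spectral_norm X"
      by (rule onorm_le)
         (simp add: norm_orthonormal_columns[OF V2] norm_matrix_vector_le flip: matrix_vector_mul_assoc)
  qed
  also have "two_inf_norm (?Y ** E11) \<le> two_inf_norm ?Y * \<epsilon>"
    by (rule two_inf_norm_mult_le_unit[OF e(1)])
  also have "two_inf_norm (?Y ** (E12 ** X)) \<le> two_inf_norm ?Y * (\<epsilon> * spectral_norm X)"
    using e(2) by (intro two_inf_norm_mult_le_unit order_trans[OF spectral_norm_mult_le] mult_right_mono) simp_all
  finally show ?thesis by (simp add: algebra_simps)
qed


section \<open>The row-wise perturbation bound\<close>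

theorem theorem3p1:
  fixes r n :: nat
    and A E Ahat :: "real^'n^'n"
    and lam :: "nat \<Rightarrow> real"
    and p1 :: "'r::finite \<Rightarrow> nat" and p2 :: "'s::finite \<Rightarrow> nat"
    and \<Lambda>1 :: "real^'r^'r" and \<Lambda>2 :: "real^'s^'s"
    and V1 Vhat1 :: "real^'r^'n" and V2 :: "real^'s^'n"
    and E21 :: "real^'r^'s" and E22 :: "real^'s^'s"
    and Ut :: "real^'r^'r"
    and gap :: real
  assumes dims: "1 \<le> r" "r < n" "CARD('n) = n" "CARD('r) = r" "CARD('s) = n - r"
    and A_sym: "transpose A = A"
    and lam_sorted: "\<forall>i\<in>{1..n}. \<forall>j\<in>{1..n}. i \<le> j \<longrightarrow> lam j \<le> lam i"
    and lam_gap: "lam r > lam (r + 1)"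
    and p1: "bij_betw p1 UNIV {1..r}" and p2: "bij_betw p2 UNIV {r+1..n}"
    and Lam1: "\<Lambda>1 = diag_mat (\<lambda>i. lam (p1 i))"
    and Lam2: "\<Lambda>2 = diag_mat (\<lambda>i. lam (p2 i))"
    and V1_on: "orthonormal_columns V1" and V2_on: "orthonormal_columns V2"
    and V1_eig: "\<forall>i. A *v column i V1 = lam (p1 i) *\<^sub>R column i V1"
    and V2_eig: "\<forall>i. A *v column i V2 = lam (p2 i) *\<^sub>R column i V2"
    and A_dec: "A = V1 ** \<Lambda>1 ** transpose V1 + V2 ** \<Lambda>2 ** transpose V2"
    and E_sym: "transpose E = E"
    and Ahat: "Ahat = A + E"
    and E21: "E21 = transpose V2 ** E ** V1"
    and E22: "E22 = transpose V2 ** E ** V2"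
    and gap: "gap = min (sep spectral_norm \<Lambda>1 \<Lambda>2)
                        (sep_in two_inf_norm V2 \<Lambda>1 (V2 ** \<Lambda>2 ** transpose V2))"
    and E_small: "spectral_norm E \<le> gap / 5"
    and Vhat1_on: "orthonormal_columns Vhat1"
    and Vhat1_dom: "dominant_invariant_subspace r Ahat (range ((*v) Vhat1))"
    and Ut: "is_arg_min (\<lambda>U. frobenius_norm (Vhat1 ** U - V1)) orthogonal_matrix Ut"
  shows "two_inf_norm (Vhat1 ** Ut - V1)
     \<le> 8 * two_inf_norm V1 * (spectral_norm E21 / sep spectral_norm \<Lambda>1 \<Lambda>2)\<^sup>2
       + 2 * (two_inf_norm (V2 ** E21) / gap)
       + 4 * ((two_inf_norm (V2 ** E22 ** transpose V2) * spectral_norm E21)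
                / (gap * sep spectral_norm \<Lambda>1 \<Lambda>2))"
proof -
  define W where "W = Vhat1 ** Ut"
  define C where "C = transpose V1 ** W"
  define S where "S = transpose V2 ** W"
  define M where "M = transpose W ** Ahat ** W"
  define E11 where "E11 = transpose V1 ** E ** V1"
  define E12 where "E12 = transpose V1 ** E ** V2"
  define \<epsilon> where "\<epsilon> = spectral_norm E"
  define e where "e = spectral_norm E21"
  define \<delta> where "\<delta> = sep spectral_norm \<Lambda>1 \<Lambda>2"
  define g where "g = lam r - lam (r + 1)"

  \<comment> \<open>Orthogonality and completeness of the eigenvector blocks\<close>
  have p1_in: "p1 i \<in> {1..r}" for i
    using p1 by (auto simp: bij_betw_def)
  have p2_in: "p2 j \<in> {r+1..n}" for j
    using p2 by (auto simp: bij_betw_def)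
  have lam1: "lam r \<le> lam (p1 i)" for i
    using p1_in[of i] dims(2) lam_sorted by force
  have lam2: "lam (p2 j) \<le> lam (r + 1)" for j
    using p2_in[of j] dims(2) lam_sorted by force

  have V12: "transpose V1 ** V2 = 0"
  proof (rule eigenvector_matrices_orthogonal[OF A_sym])
    show "lam (p1 i) \<noteq> lam (p2 j)" for i j
      using lam1[of i] lam2[of j] lam_gap by linarith
  qed (use V1_eig V2_eig in auto)
  have V21: "transpose V2 ** V1 = 0"
    using arg_cong[OF V12, of transpose] by (simp add: matrix_transpose_mul)
  have complete: "V1 ** transpose V1 + V2 ** transpose V2 = mat 1"
    using dims by (intro orthonormal_columns_complete V1_on V2_on V12) simp
  have V1A: "transpose V1 ** A = \<Lambda>1 ** transpose V1"
    by (rule transpose_mult_decomposed[OF A_dec V1_on V12])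
  have V2A: "transpose V2 ** A = \<Lambda>2 ** transpose V2"
    by (rule transpose_mult_decomposed[OF A_dec[unfolded add.commute[of "V1 ** \<Lambda>1 ** transpose V1"]] V2_on V21])

  \<comment> \<open>The aligned basis and its coordinates\<close>
  have Ut_orth: "orthogonal_matrix Ut"
    using Ut by (simp add: is_arg_min_def)
  have W_on: "orthonormal_columns W"
    unfolding W_def by (rule orthonormal_columns_mult_orthogonal[OF Vhat1_on Ut_orth])
  have W_dec: "W = V1 ** C + V2 ** S"
    using arg_cong[OF complete, of "\<lambda>B. B ** W"]
    by (simp add: C_def S_def matrix_add_rdistrib matrix_mul_assoc)
  have CS: "transpose C ** C + transpose S ** S = mat 1"
  proof -
    have "transpose C ** C + transpose S ** S = transpose W ** (V1 ** transpose V1 + V2 ** transpose V2) ** W"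
      by (simp add: C_def S_def matrix_transpose_mul matrix_add_ldistrib matrix_add_rdistrib matrix_mul_assoc)
    then show ?thesis using W_on by (simp add: complete orthonormal_columns_def)
  qed
  \<comment> \<open>Alignment by an orthogonal matrix preserves the range, so the properties of the
    dominant subspace carry over to \<open>W\<close>.\<close>
  have range_W: "range ((*v) W) = range ((*v) Vhat1)"
  proof -
    have "Vhat1 *v x = W *v (transpose Ut *v x)" for x
      using Ut_orth by (simp add: W_def matrix_vector_mul_assoc orthogonal_matrix_def flip: matrix_mul_assoc)
    moreover have "W *v x = Vhat1 *v (Ut *v x)" for x
      by (simp add: W_def matrix_vector_mul_assoc)
    ultimately show ?thesis by (auto simp: image_def)
  qed

  have C_max: "trace (C ** Q) \<le> trace C" if "orthogonal_matrix Q" for Q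
    using procrustes_trace_maximal[OF Vhat1_on Ut that] by (simp only: C_def W_def)
  have C_near: "spectral_norm (C - mat 1) \<le> (spectral_norm S)\<^sup>2"
    using trace_maximal_imp_symmetric[OF C_max] trace_maximal_imp_psd[OF C_max] CS
    by (rule spectral_norm_diff_mat_1_le)
  have C_le: "spectral_norm C \<le> 1"
  proof (rule onorm_bound)
    fix x
    have "norm (C *v x) \<le> spectral_norm V1 * norm (W *v x)"
      using norm_matrix_vector_le[of "transpose V1" "W *v x"]
      by (simp add: C_def matrix_vector_mul_assoc)
    also have "\<dots> \<le> 1 * norm x"
      unfolding norm_orthonormal_columns[OF W_on]
      by (intro mult_right_mono spectral_norm_orthonormal_columns_le[OF V1_on]) simp
    finally show "norm (C *v x) \<le> 1 * norm x" .
  qed simp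

  \<comment> \<open>Block equations of the perturbed invariant subspace\<close>
  obtain \<mu> where inv: "\<And>x. x \<in> range ((*v) W) \<Longrightarrow> Ahat *v x \<in> range ((*v) W)"
    and low: "\<And>x. x \<in> range ((*v) W) \<Longrightarrow> \<mu> * (x \<bullet> x) \<le> x \<bullet> (Ahat *v x)"
    and up: "\<And>T. subspace T \<Longrightarrow> r \<le> dim T \<Longrightarrow> \<exists>x\<in>T. x \<noteq> 0 \<and> x \<bullet> (Ahat *v x) \<le> \<mu> * (x \<bullet> x)"
    using dominant_invariant_subspace_rayleigh[OF Vhat1_dom dims(1)] unfolding range_W by metis
  have AW: "Ahat ** W = W ** M"
    unfolding M_def by (rule invariant_range_mult[OF W_on]) (simp add: inv)
  have EW: "E ** W = E ** V1 ** C + E ** V2 ** S"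
    by (subst W_dec) (simp add: matrix_add_ldistrib matrix_mul_assoc)
  \<comment> \<open>Multiplying \<open>Ahat W = W M\<close> by \<open>V1\<^sup>T\<close> here, and
    by \<open>V2\<^sup>T\<close> below, gives the two equations behind the Riccati equation.\<close>
  have eqC: "C ** M = \<Lambda>1 ** C + E11 ** C + E12 ** S"
  proof -
    have "C ** M = transpose V1 ** (Ahat ** W)"
      by (simp add: AW C_def matrix_mul_assoc)
    also have "\<dots> = (transpose V1 ** A) ** W + transpose V1 ** (E ** W)"
      by (simp add: Ahat matrix_add_ldistrib matrix_add_rdistrib matrix_mul_assoc)
    finally show ?thesis
      by (simp add: V1A EW C_def E11_def E12_def matrix_add_ldistrib matrix_mul_assoc)
  qed
  have eqS: "S ** M = \<Lambda>2 ** S + E21 ** C + E22 ** S"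
  proof -
    have "S ** M = transpose V2 ** (Ahat ** W)"
      by (simp add: AW S_def matrix_mul_assoc)
    also have "\<dots> = (transpose V2 ** A) ** W + transpose V2 ** (E ** W)"
      by (simp add: Ahat matrix_add_ldistrib matrix_add_rdistrib matrix_mul_assoc)
    finally show ?thesis
      by (simp add: V2A EW S_def E21 E22 matrix_add_ldistrib matrix_mul_assoc)
  qed

  \<comment> \<open>Eigenvalue bounds and the sine-theta estimate\<close>
  have \<epsilon>_nonneg: "0 \<le> \<epsilon>" by (simp add: \<epsilon>_def)
  have \<epsilon>_gap: "\<epsilon> \<le> gap / 5"
    using E_small by (simp only: \<epsilon>_def)
  then have gap_nonneg: "0 \<le> gap"
    using \<epsilon>_nonneg by linarith
  have gap_\<delta>: "gap \<le> \<delta>"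
    by (simp add: gap \<delta>_def)
  \<comment> \<open>The matrix unit pairing the neighbours \<open>lam r\<close> and
    \<open>lam (r + 1)\<close> shows that the separation is at most the eigenvalue gap
    \<open>g\<close>.\<close>
  have \<delta>_g: "\<delta> \<le> g"
  proof -
    have "r \<in> range p1" "r + 1 \<in> range p2"
      using p1 p2 dims(1,2) by (auto simp: bij_betw_def)
    then obtain i j where "p1 i = r" "p2 j = r + 1" by (metis imageE)
    then show ?thesis
      using sep_spectral_norm_diag_le[of "\<lambda>i. lam (p1 i)" "\<lambda>i. lam (p2 i)" i j] lam_gap
      by (simp add: \<delta>_def g_def Lam1 Lam2)
  qed
  have g_pos: "0 < g"
    using lam_gap by (simp add: g_def)
  have E11_le: "spectral_norm E11 \<le> \<epsilon>" and E12_le: "spectral_norm E12 \<le> \<epsilon>"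
    and e_le: "e \<le> \<epsilon>" and E22_le: "spectral_norm E22 \<le> \<epsilon>"
    by (simp_all add: E11_def E12_def e_def \<epsilon>_def E21 E22 spectral_norm_compression_le V1_on V2_on)
  have e_nonneg: "0 \<le> e" by (simp add: e_def)

  \<comment> \<open>Weyl's inequality: on the range of \<open>V1\<close> the Rayleigh quotients of
    \<open>Ahat\<close> are at least \<open>lam r - \<epsilon>\<close>, while by Courant-Fischer one
    of them is at most \<open>\<mu>\<close>.\<close>
  have \<mu>_ge: "lam r - \<epsilon> \<le> \<mu>"
  proof -
    have "\<exists>x\<in>range ((*v) V1). x \<noteq> 0 \<and> x \<bullet> (Ahat *v x) \<le> \<mu> * (x \<bullet> x)"
      by (rule up) (simp_all add: linear_subspace_image dim_range_orthonormal_columns[OF V1_on] dims)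
    then obtain y where y: "V1 *v y \<noteq> 0" "(V1 *v y) \<bullet> (Ahat *v (V1 *v y)) \<le> \<mu> * ((V1 *v y) \<bullet> (V1 *v y))"
      by blast
    let ?x = "V1 *v y"
    have tV: "transpose V1 *v ?x = y"
      using V1_on by (simp add: matrix_vector_mul_assoc orthonormal_columns_def)
    have xx: "?x \<bullet> ?x = y \<bullet> y"
      by (simp add: inner_matrix_vector tV)
    have "?x \<bullet> (A *v ?x) = y \<bullet> (transpose V1 *v (A *v ?x))"
      by (simp add: inner_matrix_vector)
    also have "transpose V1 *v (A *v ?x) = \<Lambda>1 *v y"
      using arg_cong[OF V1A, of "\<lambda>B. B *v ?x"] by (simp add: tV flip: matrix_vector_mul_assoc)
    also have "lam r * (y \<bullet> y) \<le> y \<bullet> (\<Lambda>1 *v y)"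
      unfolding Lam1 diag_mat_quadratic inner_eq_sum_squares sum_distrib_left
      by (intro sum_mono mult_right_mono lam1) simp
    finally have "lam r * (?x \<bullet> ?x) \<le> ?x \<bullet> (A *v ?x)" by (simp add: xx)
    moreover have "?x \<bullet> (Ahat *v ?x) = ?x \<bullet> (A *v ?x) + ?x \<bullet> (E *v ?x)"
      by (simp add: Ahat matrix_vector_mult_add_rdistrib inner_add_right)
    ultimately have "(lam r - \<epsilon>) * (?x \<bullet> ?x) \<le> \<mu> * (?x \<bullet> ?x)"
      using abs_inner_matrix_le[of ?x E] y(2) by (simp add: \<epsilon>_def left_diff_distrib)
    moreover have "0 < ?x \<bullet> ?x" using y(1) by simp
    ultimately show ?thesis by (rule mult_right_le_imp_le)
  qed

  \<comment> \<open>Moving \<open>E22 S\<close> to the left in the second block equation leaves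
    \<open>S M - (\<Lambda>2 + E22) S = E21 C\<close>, where the spectra of \<open>M\<close> and
    \<open>\<Lambda>2 + E22\<close> stay at least \<open>g - 2 \<epsilon>\<close> apart.\<close>
  have S_le: "3 * g * spectral_norm S \<le> 5 * e"
  proof -
    have M_low: "(lam r - \<epsilon>) * (u \<bullet> u) \<le> u \<bullet> (M *v u)" for u
    proof -
      have "u \<bullet> (M *v u) = (W *v u) \<bullet> (Ahat *v (W *v u))"
        by (simp add: M_def inner_matrix_vector matrix_transpose_mul flip: matrix_vector_mul_assoc)
      moreover have "\<mu> * ((W *v u) \<bullet> (W *v u)) \<le> (W *v u) \<bullet> (Ahat *v (W *v u))"
        by (rule low) simp
      moreover have "(W *v u) \<bullet> (W *v u) = u \<bullet> u"
        by (simp add: dot_square_norm norm_orthonormal_columns[OF W_on])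
      ultimately show ?thesis
        using mult_right_mono[OF \<mu>_ge, of "u \<bullet> u"] by simp
    qed
    have N_up: "y \<bullet> ((\<Lambda>2 + E22) *v y) \<le> (lam (r + 1) + \<epsilon>) * (y \<bullet> y)" for y
    proof -
      have "y \<bullet> (\<Lambda>2 *v y) \<le> lam (r + 1) * (y \<bullet> y)"
        unfolding Lam2 diag_mat_quadratic inner_eq_sum_squares sum_distrib_left
        by (intro sum_mono mult_right_mono lam2) simp
      moreover have "y \<bullet> (E22 *v y) \<le> \<epsilon> * (y \<bullet> y)"
        using abs_inner_matrix_le[of y E22] mult_right_mono[OF E22_le, of "y \<bullet> y"] by simp
      ultimately show ?thesis
        by (simp add: matrix_vector_mult_add_rdistrib inner_add_right distrib_right)
    qed
    have "(lam r - \<epsilon> - (lam (r + 1) + \<epsilon>)) * spectral_norm S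
        \<le> spectral_norm (S ** M - (\<Lambda>2 + E22) ** S)"
      by (rule spectral_norm_sylvester_ge[OF M_low N_up])
    also have "S ** M - (\<Lambda>2 + E22) ** S = E21 ** C"
      by (simp add: eqS matrix_add_rdistrib)
    also have "spectral_norm (E21 ** C) \<le> e * 1"
      unfolding e_def by (intro order_trans[OF spectral_norm_mult_le] mult_left_mono C_le) simp
    finally have "(g - 2 * \<epsilon>) * spectral_norm S \<le> e" by (simp add: g_def algebra_simps)
    \<comment> \<open>The factor \<open>3 / 5\<close> comes from
      \<open>\<epsilon> \<le> gap / 5 \<le> g / 5\<close>.\<close>
    moreover have "(3 / 5 * g) * spectral_norm S \<le> (g - 2 * \<epsilon>) * spectral_norm S"
      using \<epsilon>_gap gap_\<delta> \<delta>_g by (intro mult_right_mono) simp_all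
    ultimately show ?thesis by simp
  qed
  \<comment> \<open>The chain is \<open>3 g \<parallel>S\<parallel> \<le> 5 e \<le> 5 \<epsilon>
    \<le> gap \<le> g\<close>.\<close>
  have S_third: "spectral_norm S \<le> 1 / 3"
  proof -
    have "g * (3 * spectral_norm S) \<le> g * 1"
      using S_le e_le \<epsilon>_gap gap_\<delta> \<delta>_g by simp
    then show ?thesis using g_pos by simp
  qed

  \<comment> \<open>The row-wise estimate\<close>
  let ?v = "two_inf_norm V1" and ?a = "two_inf_norm (V2 ** E21)"
    and ?b = "two_inf_norm (V2 ** E22 ** transpose V2)"
  have goal_eq: "two_inf_norm (Vhat1 ** Ut - V1) = two_inf_norm (V1 ** (C - mat 1) + V2 ** S)"
    by (simp add: W_dec matrix_diff_ldistrib diff_add_eq flip: W_def)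
  have "two_inf_norm (V1 ** (C - mat 1) + V2 ** S)
      \<le> 8 * ?v * (e / \<delta>)\<^sup>2 + 2 * (?a / gap) + 4 * ((?b * e) / (gap * \<delta>))"
  proof (cases "gap = 0")
    \<comment> \<open>Here the quotients by \<open>gap\<close> are \<open>0\<close>, so the left-hand side has to vanish.\<close>
    case True
    \<comment> \<open>With \<open>gap = 0\<close> also \<open>\<epsilon>\<close> and
      \<open>e\<close> vanish. The positive eigenvalue gap \<open>g\<close> then gives
      \<open>S = 0\<close>, and \<open>C_near\<close> gives \<open>C = mat 1\<close>.\<close>
    then have "g * (3 * spectral_norm S) \<le> g * 0"
      using S_le e_le \<epsilon>_gap by simp
    then have "spectral_norm S = 0"
      using g_pos by (simp only: mult_le_cancel_left_pos) (simp add: order_antisym)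
    then have "two_inf_norm (V1 ** (C - mat 1)) \<le> ?v * 0" "two_inf_norm (V2 ** S) \<le> two_inf_norm V2 * 0"
      using C_near by (intro two_inf_norm_mult_le_unit; simp)+
    then have "two_inf_norm (V1 ** (C - mat 1) + V2 ** S) \<le> 0"
      using two_inf_norm_add_le[of "V1 ** (C - mat 1)" "V2 ** S"] by simp
    also have "0 \<le> 8 * ?v * (e / \<delta>)\<^sup>2 + 2 * (?a / gap) + 4 * ((?b * e) / (gap * \<delta>))"
      using gap_nonneg gap_\<delta> e_nonneg by simp
    finally show ?thesis .
  next
    case False
    then have gap_pos: "0 < gap" and \<delta>_pos: "0 < \<delta>"
      using gap_nonneg gap_\<delta> by linarith+
    have S_e: "spectral_norm S \<le> 5 / 3 * (e / \<delta>)"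
    proof -
      have "\<delta> * spectral_norm S \<le> g * spectral_norm S"
        using \<delta>_g by (intro mult_right_mono) simp_all
      then have "3 * (\<delta> * spectral_norm S) \<le> 5 * e"
        using S_le by simp
      then show ?thesis using \<delta>_pos by (simp add: field_simps)
    qed
    \<comment> \<open>Squaring \<open>1 / 3\<close> gives \<open>q = 1 / 9\<close>, hence an inverse
      of norm at most \<open>1 / (1 - q) = 9 / 8\<close>.\<close>
    have "spectral_norm (C - mat 1) \<le> 1 / 9"
      using C_near power_mono[OF S_third, of 2] by (simp add: power2_eq_square)
    then obtain D where D: "C ** D = mat 1" "D ** C = mat 1" and D_le: "spectral_norm D \<le> 9 / 8"
      by (rule inverse_near_mat_1) simp_all
    define X where "X = S ** D"
    have S_eq: "S = X ** C"
      using D by (simp add: X_def flip: matrix_mul_assoc)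
    have X_S: "spectral_norm X \<le> spectral_norm S * (9 / 8)"
      unfolding X_def by (intro order_trans[OF spectral_norm_mult_le] mult_left_mono D_le) simp
    then have X_e: "spectral_norm X \<le> 15 / 8 * (e / \<delta>)" and X_le: "spectral_norm X \<le> 3 / 8"
      using S_e S_third by simp_all
    let ?y = "two_inf_norm (V2 ** X)"
    have "gap * ?y \<le> sep_in two_inf_norm V2 \<Lambda>1 (V2 ** \<Lambda>2 ** transpose V2) * ?y"
      by (intro mult_right_mono) (simp_all add: gap)
    also have "\<dots> \<le> ?a + ?b * spectral_norm X + ?y * (\<epsilon> + \<epsilon> * spectral_norm X)"
      by (rule two_inf_norm_riccati_le[OF V2_on riccati_of_invariant[OF eqC eqS D X_def] E11_le E12_le])
    also have "?b * spectral_norm X \<le> 15 / 8 * (?b * (e / \<delta>))"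
      using mult_left_mono[OF X_e, of ?b] by (simp only: two_inf_norm_nonneg mult.left_commute)
    \<comment> \<open>Here \<open>1 / 5 * (1 + 3 / 8) = 11 / 40\<close>; absorbing this term leaves
      the factor \<open>29 / 40\<close> on the left.\<close>
    also have "?y * (\<epsilon> + \<epsilon> * spectral_norm X) \<le> 11 / 40 * (gap * ?y)"
    proof -
      have "\<epsilon> * spectral_norm X \<le> (gap / 5) * (3 / 8)"
        using \<epsilon>_gap X_le gap_nonneg by (intro mult_mono) simp_all
      then have "\<epsilon> + \<epsilon> * spectral_norm X \<le> 11 / 40 * gap"
        using \<epsilon>_gap by simp
      from mult_left_mono[OF this, of ?y] show ?thesis
        by (simp add: mult_ac)
    qed
    finally have "29 / 40 * (gap * ?y) \<le> ?a + 15 / 8 * (?b * (e / \<delta>))"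
      by linarith
    moreover have "0 \<le> ?b * (e / \<delta>)"
      using e_nonneg \<delta>_pos by simp
    \<comment> \<open>Division by \<open>29 / 40\<close> gives the coefficients
      \<open>40 / 29 \<le> 2\<close> and \<open>75 / 29 \<le> 4\<close>.\<close>
    ultimately have "gap * ?y \<le> 2 * ?a + 4 * (?b * (e / \<delta>))"
      using two_inf_norm_nonneg[of "V2 ** E21"] by linarith
    then have "?y \<le> (2 * ?a + 4 * (?b * (e / \<delta>))) / gap"
      using gap_pos by (simp add: pos_le_divide_eq mult.commute)
    also have "\<dots> = 2 * (?a / gap) + 4 * ((?b * e) / (gap * \<delta>))"
      by (simp add: add_divide_distrib)
    finally have y_le: "?y \<le> 2 * (?a / gap) + 4 * ((?b * e) / (gap * \<delta>))" .
    have "spectral_norm (C - mat 1) \<le> (5 / 3 * (e / \<delta>))\<^sup>2"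
      using C_near power_mono[OF S_e, of 2] by simp
    \<comment> \<open>The constant needed is \<open>(5 / 3)\<^sup>2 = 25 / 9\<close>, which is below
      \<open>8\<close>.\<close>
    also have "\<dots> \<le> 8 * (e / \<delta>)\<^sup>2"
      unfolding power_mult_distrib by (intro mult_right_mono) (simp_all add: power2_eq_square)
    finally have "two_inf_norm (V1 ** (C - mat 1)) \<le> ?v * (8 * (e / \<delta>)\<^sup>2)"
      by (rule two_inf_norm_mult_le_unit)
    \<comment> \<open>Since \<open>V2 S = (V2 X) C\<close> and \<open>C\<close> is a contraction,
      the row bound for \<open>V2 X\<close> passes to \<open>V2 S\<close>.\<close>
    moreover have "two_inf_norm (V2 ** S) \<le> ?y * 1"
      unfolding S_eq matrix_mul_assoc by (rule two_inf_norm_mult_le_unit[OF C_le])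
    ultimately show ?thesis
      using two_inf_norm_add_le[of "V1 ** (C - mat 1)" "V2 ** S"] y_le by simp
  qed
  then show ?thesis
    unfolding goal_eq by (simp add: e_def \<delta>_def)
qed

end
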